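(* (i) Let $\tau=123$. Then $\lim_{n\to\infty}\mu_n^{\tau}=\delta_{\infty^{(\infty)}}$. (ii) Let $\tau=132$. Then $\lim_{n\to\infty}\mu_n^{\tau}=\delta_{\infty^{(\infty)}}$. In both cases the limit is in the sense of weak convergence of probability measures on the compact metric space $S(\mathbb{N},\mathbb{N}^* )$.
   Context: $\mathbb{N}=\{1,2,\dots\}$ and $[n]=\{1,\dots,n\}$. $S_n$ is the set of permutations $\sigma=\sigma_1\cdots\sigma_n$ of $[n]$. For $\tau=\tau_1\cdots\tau_m\in S_m$, a permutation $\sigma\in S_n$ contains $\tau$ if there are indices $i_1<\cdots<i_m$ such that for all $1\le j,k\le m$, $\sigma_{i_j}<\sigma_{i_k}$ if and only if $\tau_j<\tau_k$; otherwise $\sigma$ avoids $\tau$. $S_n(\tau)$ is the set of $\tau$-avoiding permutations in $S_n$, and $\mu_n^\tau$ is the uniform probability measure on $S_n(\tau)$. $\mathbb{N}^*=\mathbb{N}\cup\{\infty\}$ carries the metric $d_{\mathbb{N}^*}(i,j)=\sum_{k=i}^{j-1}2^{-k}$ for $1\le i<j\le\infty$. $S(\mathbb{N},\mathbb{N}^* )$ is the set of functions $\sigma=\{\sigma_i\}_{i=1}^\infty$ from $\mathbb{N}$ to $\mathbb{N}^*$ that are injective on $\sigma^{-1}(\mathbb{N})$ (i.e. $\sigma_i=\sigma_j$ with $i\ne j$ implies $\sigma_i=\infty$), with the metric $D(\sigma,\rho)=\sum_{i=1}^\infty 2^{-i}d_{\mathbb{N}^*}(\sigma_i,\rho_i)$;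 it is a compact metric space. $S_n$ is regarded as a subset of $S(\mathbb{N},\mathbb{N}^* )$ by setting $\sigma_j=j$ for $j>n$, so $\mu_n^\tau$ is a probability measure on $S(\mathbb{N},\mathbb{N}^* )$. $\infty^{(\infty)}\in S(\mathbb{N},\mathbb{N}^* )$ denotes the function with $\sigma_i=\infty$ for all $i\in\mathbb{N}$, and $\delta_{\infty^{(\infty)}}$ is the point mass at it. *)

theory Defs
  imports
    "HOL-Probability.Probability"
    "HOL-Combinatorics.Permutations"
    "HOL-Library.Extended_Nat"
begin

section \<open>Pattern-avoiding permutations\<close>

text \<open>
  A permutation of \<open>[n]\<close> is a function permuting \<open>{1..n}\<close>, so it fixes every \<open>j > n\<close>
  (and the irrelevant argument \<open>0\<close>).
\<close>

definition Sym :: "nat \<Rightarrow> (nat \<Rightarrow> nat) set" where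
  "Sym n = {\<sigma>. \<sigma> permutes {1..n}}"

text \<open>The permutation with one-line notation \<open>w\<close>: entry \<open>i\<close> of the word, counted from 1.\<close>

definition one_line :: "nat list \<Rightarrow> nat \<Rightarrow> nat" where
  "one_line w i = (if i \<in> {1..length w} then w ! (i - 1) else i)"

definition contains_pattern :: "nat \<Rightarrow> (nat \<Rightarrow> nat) \<Rightarrow> nat \<Rightarrow> (nat \<Rightarrow> nat) \<Rightarrow> bool" where
  "contains_pattern n \<sigma> m \<tau> \<longleftrightarrow>
     (\<exists>i. strict_mono_on {1..m} i \<and> i ` {1..m} \<subseteq> {1..n} \<and>
          (\<forall>j\<in>{1..m}. \<forall>k\<in>{1..m}. \<sigma> (i j) < \<sigma> (i k) \<longleftrightarrow> \<tau> j < \<tau> k))"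

definition Avoiding :: "nat \<Rightarrow> nat \<Rightarrow> (nat \<Rightarrow> nat) \<Rightarrow> (nat \<Rightarrow> nat) set" where
  "Avoiding n m \<tau> = {\<sigma> \<in> Sym n. \<not> contains_pattern n \<sigma> m \<tau>}"

lemma one_line_123_in_Sym: "one_line [1, 2, 3] \<in> Sym 3"
proof -
  have "one_line [1, 2, 3] = id"
    by (auto simp: one_line_def fun_eq_iff nth_Cons' numeral_2_eq_2 numeral_3_eq_3)
  then show ?thesis
    by (simp add: Sym_def permutes_id)
qed

lemma one_line_132_in_Sym: "one_line [1, 3, 2] \<in> Sym 3"
proof -
  have "one_line [1, 3, 2] = Transposition.transpose 2 3"
    by (auto simp: one_line_def fun_eq_iff nth_Cons' Transposition.transpose_def)
  then show ?thesis
    by (simp add: Sym_def permutes_swap_id)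
qed


section \<open>The metric space of sequences\<close>

text \<open>
  The extended natural numbers with infinity are \<open>{1..} :: enat set\<close>. The sum
  over \<open>k\<close> from \<open>min i j\<close> to \<open>max i j - 1\<close> is infinite when one of the two points is \<open>\<infinity>\<close>.
\<close>

definition dist_enat :: "enat \<Rightarrow> enat \<Rightarrow> real" where
  "dist_enat i j = (\<Sum>\<^sub>\<infinity>k\<in>{k :: nat. min i j \<le> enat k \<and> enat k < max i j}. (1 / 2) ^ k)"

text \<open>Sequences are indexed by \<open>{1..}\<close>; extensionality makes the value at \<open>0\<close> carry no information.\<close>

definition SNN :: "(nat \<Rightarrow> enat) set" where
  "SNN = {\<sigma> \<in> {1..} \<rightarrow>\<^sub>E {1..}. inj_on \<sigma> {i \<in> {1..}. \<sigma> i \<noteq> \<infinity>}}"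

definition D :: "(nat \<Rightarrow> enat) \<Rightarrow> (nat \<Rightarrow> enat) \<Rightarrow> real" where
  "D \<sigma> \<rho> = (\<Sum>i. (1 / 2) ^ Suc i * dist_enat (\<sigma> (Suc i)) (\<rho> (Suc i)))"

lemma half_summable_on: "(\<lambda>k::nat. (1 / 2 :: real) ^ k) summable_on A"
proof -
  have "(\<lambda>k::nat. (1 / 2 :: real) ^ k) summable_on UNIV"
    by (intro summable_nonneg_imp_summable_on summable_geometric) auto
  then show ?thesis
    by (rule summable_on_subset_banach) simp
qed

lemma dist_enat_nonneg: "0 \<le> dist_enat i j"
  unfolding dist_enat_def by (intro infsum_nonneg) simp

lemma dist_enat_commute: "dist_enat i j = dist_enat j i"
  by (simp add: dist_enat_def min.commute max.commute)

lemma dist_enat_le: "dist_enat i j \<le> (\<Sum>\<^sub>\<infinity>k::nat. (1 / 2) ^ k)"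
  unfolding dist_enat_def by (intro infsum_mono2 half_summable_on) auto

lemma dist_enat_eq_0_iff: "dist_enat i j = 0 \<longleftrightarrow> i = j"
proof
  assume eq: "dist_enat i j = 0"
  show "i = j"
  proof (rule ccontr)
    assume "i \<noteq> j"
    then have lt: "min i j < max i j"
      by (auto simp: min_def max_def)
    then obtain k where k: "min i j = enat k"
      by (metis enat_ord_simps(4) less_infinityE order_less_le_trans enat_ord_code(3))
    have "(\<Sum>l\<in>{k}. (1 / 2 :: real) ^ l) \<le> dist_enat i j"
      unfolding dist_enat_def using lt k
      by (intro finite_sum_le_infsum half_summable_on) auto
    then have "(1 / 2 :: real) ^ k \<le> 0"
      using eq by simp
    then show False
      by (simp flip: not_less)
  qed
next
  assume "i = j"
  then show "dist_enat i j = 0"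
    by (auto simp: dist_enat_def intro!: infsum_0)
qed

lemma dist_enat_triangle: "dist_enat i l \<le> dist_enat i j + dist_enat j l"
proof -
  define A where "A i j = {k :: nat. min i j \<le> enat k \<and> enat k < max i j}" for i j
  define s where "s = infsum (\<lambda>k::nat. (1 / 2 :: real) ^ k)"
  have "A i l \<subseteq> A i j \<union> (A j l - A i j)"
    by (auto simp: A_def min_def max_def split: if_splits)
  then have "s (A i l) \<le> s (A i j \<union> (A j l - A i j))"
    unfolding s_def by (intro infsum_mono2 half_summable_on) auto
  also have "\<dots> = s (A i j) + s (A j l - A i j)"
    unfolding s_def by (intro infsum_Un_disjoint half_summable_on) auto
  also have "s (A j l - A i j) \<le> s (A j l)"
    unfolding s_def by (intro infsum_mono2 half_summable_on) auto
  finally show ?thesis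
    by (simp add: dist_enat_def A_def s_def)
qed

lemma D_summable: "summable (\<lambda>i. (1 / 2) ^ Suc i * dist_enat (\<sigma> (Suc i)) (\<rho> (Suc i)))"
proof (rule summable_comparison_test')
  show "summable (\<lambda>i. (1 / 2 :: real) ^ Suc i * (\<Sum>\<^sub>\<infinity>k::nat. (1 / 2) ^ k))"
    by (intro summable_mult2) (subst summable_Suc_iff, intro summable_geometric, simp)
  show "norm ((1 / 2) ^ Suc i * dist_enat (\<sigma> (Suc i)) (\<rho> (Suc i)))
      \<le> (1 / 2) ^ Suc i * (\<Sum>\<^sub>\<infinity>k::nat. (1 / 2) ^ k)" for i
    using dist_enat_le by (simp add: dist_enat_nonneg abs_mult mult_left_mono)
qed

interpretation SNN: Metric_space SNN D
proof
  show "0 \<le> D \<sigma> \<rho>" for \<sigma> \<rho>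
    unfolding D_def by (intro suminf_nonneg D_summable) (simp add: dist_enat_nonneg)
  show "D \<sigma> \<rho> = D \<rho> \<sigma>" for \<sigma> \<rho>
    by (simp add: D_def dist_enat_commute)
  show "D \<sigma> \<rho> = 0 \<longleftrightarrow> \<sigma> = \<rho>" if "\<sigma> \<in> SNN" "\<rho> \<in> SNN" for \<sigma> \<rho>
  proof -
    have "D \<sigma> \<rho> = 0 \<longleftrightarrow> (\<forall>i. \<sigma> (Suc i) = \<rho> (Suc i))"
      unfolding D_def
      by (subst suminf_eq_zero_iff[OF D_summable]) (auto simp: dist_enat_nonneg dist_enat_eq_0_iff)
    also have "\<dots> \<longleftrightarrow> (\<forall>i\<in>{1..}. \<sigma> i = \<rho> i)"
      by (metis Suc_le_D Suc_le_eq atLeast_iff One_nat_def zero_less_Suc)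
    also have "\<dots> \<longleftrightarrow> \<sigma> = \<rho>"
      using that by (auto simp: SNN_def intro: PiE_ext)
    finally show ?thesis .
  qed
  show "D \<sigma> \<upsilon> \<le> D \<sigma> \<rho> + D \<rho> \<upsilon>" for \<sigma> \<rho> \<upsilon>
    unfolding D_def suminf_add[OF D_summable D_summable]
    by (intro suminf_le D_summable summable_add)
       (simp add: dist_enat_triangle flip: distrib_left)
qed

definition infinity_seq :: "nat \<Rightarrow> enat" where
  "infinity_seq = (\<lambda>i\<in>{1..}. \<infinity>)"

definition embed :: "(nat \<Rightarrow> nat) \<Rightarrow> nat \<Rightarrow> enat" where
  "embed \<sigma> = (\<lambda>i\<in>{1..}. enat (\<sigma> i))"

lemma infinity_seq_in_SNN: "infinity_seq \<in> SNN"
  by (auto simp: infinity_seq_def SNN_def inj_on_def)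

lemma embed_in_SNN:
  assumes "\<sigma> \<in> Sym n"
  shows "embed \<sigma> \<in> SNN"
proof -
  have "\<sigma> permutes {1..n}"
    using assms by (simp add: Sym_def)
  then have "inj \<sigma>" "\<sigma> 0 = 0"
    by (auto simp: permutes_inj permutes_not_in)
  then have "\<sigma> i \<ge> 1" if "i \<ge> 1" for i
    using that by (metis One_nat_def Suc_le_eq injD neq0_conv)
  with \<open>inj \<sigma>\<close> show ?thesis
    by (auto simp: embed_def SNN_def inj_on_def one_enat_def)
qed


section \<open>Weak convergence\<close>

definition borel_of :: "'a topology \<Rightarrow> 'a measure" where
  "borel_of X = sigma (topspace X) {U. openin X U}"

definition weak_conv_on :: "'a topology \<Rightarrow> (nat \<Rightarrow> 'a measure) \<Rightarrow> 'a measure \<Rightarrow> bool" where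
  "weak_conv_on X M N \<longleftrightarrow>
     (\<forall>n. prob_space (M n) \<and> sets (M n) = sets (borel_of X)) \<and>
     prob_space N \<and> sets N = sets (borel_of X) \<and>
     (\<forall>f. continuous_map X euclideanreal f \<and> bounded (f ` topspace X) \<longrightarrow>
          (\<lambda>n. \<integral>\<sigma>. f \<sigma> \<partial>M n) \<longlonglongrightarrow> (\<integral>\<sigma>. f \<sigma> \<partial>N))"

text \<open>The uniform distribution on \<open>S\<^sub>n(\<tau>)\<close>, regarded as a Borel measure on the space of sequences.\<close>

definition \<mu> :: "nat \<Rightarrow> (nat \<Rightarrow> nat) \<Rightarrow> nat \<Rightarrow> (nat \<Rightarrow> enat) measure" where
  "\<mu> m \<tau> n = distr (uniform_count_measure (Avoiding n m \<tau>)) (borel_of SNN.mtopology) embed"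

end

theory Submission
  imports Defs "HOL-Real_Asymp.Real_Asymp"
begin

text \<open>
  Let \<open>\<tau>\<close> be 123 or 132. If \<open>\<sigma>\<close> avoids \<open>\<tau>\<close> and \<open>\<sigma> i = k\<close>, then the entries to the right of position \<open>i\<close>
  with values above \<open>k\<close> are monotone, decreasing for 123 and increasing for 132. Hence \<open>\<sigma>\<close> is
  determined by its first \<open>i\<close> entries and the positions of the values \<open>1, \<dots>, k\<close>, so for fixed \<open>i\<close> and
  \<open>k\<close> there are at most \<open>n ^ (i + k)\<close> such \<open>\<sigma>\<close>, whereas \<open>S\<^sub>n(\<tau>)\<close> has at least \<open>2 ^ (n - 1)\<close> elements.
  So every entry tends to infinity in probability, which is weak convergence to the point mass at
  the constant sequence \<open>\<infinity>\<close>.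
\<close>

section \<open>Avoidance of three-letter patterns that begin with their minimum\<close>

text \<open>As \<open>\<tau> 1 = 1\<close> forces the other two letters above the first, an
  occurrence is a position \<open>a\<close> with two later, larger entries ordered as
  \<open>\<tau> 2\<close> and \<open>\<tau> 3\<close> are. By injectivity the negation is the
  reverse order, so the truth value of \<open>\<tau> 2 < \<tau> 3\<close> covers both patterns at
  once.\<close>

lemma Avoiding_iff:
  assumes \<tau>: "\<tau> \<in> Sym 3" "\<tau> 1 = 1" and \<sigma>: "\<sigma> \<in> Sym n"
  shows "\<sigma> \<in> Avoiding n 3 \<tau> \<longleftrightarrow>
    (\<forall>a b c. 1 \<le> a \<and> a < b \<and> b < c \<and> c \<le> n \<and> \<sigma> a < \<sigma> b \<and> \<sigma> a < \<sigma> c \<longrightarrow>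
       (\<sigma> b < \<sigma> c \<longleftrightarrow> \<not> \<tau> 2 < \<tau> 3))"
proof -
  have \<tau>p: "\<tau> permutes {1..3}" and \<sigma>p: "\<sigma> permutes {1..n}"
    using \<tau> \<sigma> by (auto simp: Sym_def)
  have inj: "inj \<tau>" "inj \<sigma>"
    using \<tau>p \<sigma>p by (auto intro: permutes_inj)
  have set3: "{1..3::nat} = {1, 2, 3}"
    by auto
  have "\<tau> 2 \<in> {1..3}" "\<tau> 3 \<in> {1..3}"
    using permutes_in_image[OF \<tau>p] by auto
  moreover have "\<tau> 2 \<noteq> \<tau> 1" "\<tau> 3 \<noteq> \<tau> 1" and ne: "\<tau> 2 \<noteq> \<tau> 3"
    using inj(1) by (simp_all add: inj_eq)
  ultimately have lt: "1 < \<tau> 2" "1 < \<tau> 3"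
    using \<tau>(2) by auto
  have "contains_pattern n \<sigma> 3 \<tau> \<longleftrightarrow>
    (\<exists>a b c. 1 \<le> a \<and> a < b \<and> b < c \<and> c \<le> n \<and> \<sigma> a < \<sigma> b \<and> \<sigma> a < \<sigma> c \<and>
       (\<sigma> b < \<sigma> c \<longleftrightarrow> \<tau> 2 < \<tau> 3))" (is "_ \<longleftrightarrow> ?R")
  proof
    assume "contains_pattern n \<sigma> 3 \<tau>"
    then obtain i where i: "strict_mono_on {1..3} i" "i ` {1..3} \<subseteq> {1..n}"
      and ord: "\<forall>j\<in>{1..3}. \<forall>k\<in>{1..3}. \<sigma> (i j) < \<sigma> (i k) \<longleftrightarrow> \<tau> j < \<tau> k"
      unfolding contains_pattern_def by blast
    have "i 1 < i 2" "i 2 < i 3"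
      using i(1) by (auto simp: strict_mono_on_def)
    moreover have "1 \<le> i 1" "i 3 \<le> n"
      using i(2) unfolding set3 by auto
    moreover have "\<sigma> (i 1) < \<sigma> (i 2)" "\<sigma> (i 1) < \<sigma> (i 3)"
      "\<sigma> (i 2) < \<sigma> (i 3) \<longleftrightarrow> \<tau> 2 < \<tau> 3"
      using ord lt \<tau>(2) unfolding set3 by auto
    ultimately show ?R
      by blast
  next
    assume ?R
    then obtain a b c where abc: "1 \<le> a" "a < b" "b < c" "c \<le> n" "\<sigma> a < \<sigma> b" "\<sigma> a < \<sigma> c"
      "\<sigma> b < \<sigma> c \<longleftrightarrow> \<tau> 2 < \<tau> 3"
      by blast
    define i where "i j = (if j = 1 then a else if j = 2 then b else c)" for j :: nat
    have [simp]: "i (Suc 0) = a" "i 1 = a" "i 2 = b" "i 3 = c"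
      by (simp_all add: i_def)
    have "\<sigma> b \<noteq> \<sigma> c"
      using inj(2) abc by (simp add: inj_eq)
    then have "\<forall>j\<in>{1..3}. \<forall>k\<in>{1..3}. \<sigma> (i j) < \<sigma> (i k) \<longleftrightarrow> \<tau> j < \<tau> k"
      unfolding set3 using abc(5-7) lt \<tau>(2) ne by auto
    moreover have "strict_mono_on {1..3} i" "i ` {1..3} \<subseteq> {1..n}"
      unfolding set3 strict_mono_on_def using abc(1-4) by auto
    ultimately show "contains_pattern n \<sigma> 3 \<tau>"
      unfolding contains_pattern_def by blast
  qed
  then show ?thesis
    using \<sigma> unfolding Avoiding_def by blast
qed

lemma finite_Avoiding: "finite (Avoiding n m \<tau>)"
  by (rule finite_subset[OF _ finite_permutations[of "{1..n}"]]) (auto simp: Avoiding_def Sym_def)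

section \<open>Upper bound for the number of avoiders with a prescribed entry\<close>

text \<open>If \<open>f x < g x\<close>, write \<open>f x = g y\<close>. Then
  \<open>g y < g x\<close>, so \<open>f y < f x = g y\<close>, against the induction hypothesis at
  \<open>y\<close>.\<close>

lemma order_agree_imp_le:
  fixes f g :: "'a \<Rightarrow> 'b::wellorder"
  assumes im: "f ` P \<subseteq> g ` P"
    and ord: "\<And>x y. x \<in> P \<Longrightarrow> y \<in> P \<Longrightarrow> g x < g y \<Longrightarrow> f x < f y"
    and "x \<in> P"
  shows "g x \<le> f x"
  using \<open>x \<in> P\<close>
proof (induction "g x" arbitrary: x rule: less_induct)
  case less
  show ?case
  proof (rule ccontr)
    assume "\<not> g x \<le> f x"
    moreover obtain y where y: "y \<in> P" "f x = g y"
      using im less.prems by blast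
    ultimately have "g y < g x"
      by simp
    with less.hyps[of y] ord[of y x] y less.prems show False
      by auto
  qed
qed

text \<open>Values known as a set and in relative order are known individually. This recovers the
  part of a permutation that monotonicity controls.\<close>

lemma order_agree_imp_eq:
  fixes f g :: "'a \<Rightarrow> 'b::wellorder"
  assumes "f ` P = g ` P"
    and "\<And>x y. x \<in> P \<Longrightarrow> y \<in> P \<Longrightarrow> f x < f y \<longleftrightarrow> g x < g y"
    and "x \<in> P"
  shows "f x = g x"
  using order_agree_imp_le[of f P g x] order_agree_imp_le[of g P f x] assms
  by (intro order_antisym) auto

text \<open>The map \<open>F\<close> records the first \<open>i\<close> entries and the positions of
  the values \<open>1\<close> to \<open>k\<close>; the bound counts such pairs of functions into
  \<open>{1..n}\<close>. On \<open>?S\<close> it is injective, since the entries it leaves open form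
  a known set of values in an order prescribed by the pattern.\<close>

lemma card_Avoiding_value_le:
  assumes \<tau>: "\<tau> \<in> Sym 3" "\<tau> 1 = 1" and i: "1 \<le> i" "i \<le> n" and k: "k \<le> n"
  shows "card {\<sigma> \<in> Avoiding n 3 \<tau>. \<sigma> i = k} \<le> n ^ (i + k)"
proof -
  let ?S = "{\<sigma> \<in> Avoiding n 3 \<tau>. \<sigma> i = k}"
  let ?T = "({1..i} \<rightarrow>\<^sub>E {1..n}) \<times> ({1..k} \<rightarrow>\<^sub>E {1..n})"
  define F where "F \<sigma> = (restrict \<sigma> {1..i}, restrict (inv \<sigma>) {1..k})" for \<sigma> :: "nat \<Rightarrow> nat"
  have perm: "\<sigma> permutes {1..n}" if "\<sigma> \<in> ?S" for \<sigma>
    using that by (auto simp: Avoiding_def Sym_def)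
  \<comment> \<open>Entry \<open>i\<close>, of value \<open>k\<close>, serves as the least letter of
    the pattern. The right-hand side does not mention \<open>\<sigma>\<close>, so two members of
    \<open>?S\<close> to which this applies order \<open>b\<close> and \<open>c\<close>
    alike.\<close>
  have tail: "\<sigma> b < \<sigma> c \<longleftrightarrow> (if b < c then \<not> \<tau> 2 < \<tau> 3 else b \<noteq> c \<and> \<tau> 2 < \<tau> 3)"
    if "\<sigma> \<in> ?S" "b \<in> {i<..n}" "c \<in> {i<..n}" "k < \<sigma> b" "k < \<sigma> c" for \<sigma> b c
  proof -
    have "\<sigma> \<in> Sym n"
      using that(1) by (auto simp: Avoiding_def)
    note av = Avoiding_iff[OF \<tau> this]
    have inj: "\<sigma> b = \<sigma> c \<longleftrightarrow> b = c"
      using perm[OF that(1)] by (auto dest: permutes_inj simp: inj_eq)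
    have key: "\<sigma> x < \<sigma> y \<longleftrightarrow> \<not> \<tau> 2 < \<tau> 3"
      if "x < y" "i < x" "y \<le> n" "\<sigma> i < \<sigma> x" "\<sigma> i < \<sigma> y" for x y
      using \<open>\<sigma> \<in> ?S\<close> i(1) that av by blast
    have "\<sigma> b < \<sigma> c \<longleftrightarrow> \<not> \<tau> 2 < \<tau> 3" if "b < c"
      using key[of b c] that \<open>\<sigma> \<in> ?S\<close> \<open>b \<in> _\<close> \<open>c \<in> _\<close> \<open>k < \<sigma> b\<close> \<open>k < \<sigma> c\<close> by simp
    moreover have "\<sigma> c < \<sigma> b \<longleftrightarrow> \<not> \<tau> 2 < \<tau> 3" if "c < b"
      using key[of c b] that \<open>\<sigma> \<in> ?S\<close> \<open>b \<in> _\<close> \<open>c \<in> _\<close> \<open>k < \<sigma> b\<close> \<open>k < \<sigma> c\<close> by simp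
    ultimately show ?thesis
      using inj by (metis linorder_neqE_nat order_less_asym order_less_irrefl)
  qed
  have "inj_on F ?S"
  proof (rule inj_onI)
    fix \<sigma> \<rho> assume \<sigma>: "\<sigma> \<in> ?S" and \<rho>: "\<rho> \<in> ?S" and eq: "F \<sigma> = F \<rho>"
    note \<sigma>p = perm[OF \<sigma>] and \<rho>p = perm[OF \<rho>]
    have pos: "\<sigma> p = \<rho> p" if "p \<le> i" for p
    proof (cases "p = 0")
      case True
      then show ?thesis
        using \<sigma>p \<rho>p by (simp add: permutes_not_in)
    next
      case False
      then show ?thesis
        using fun_cong[of _ _ p] eq that by (fastforce simp: F_def restrict_def)
    qed
    have val: "inv \<sigma> v = inv \<rho> v" if "v \<le> k" for v
    proof (cases "v = 0")
      case True
      then show ?thesis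
        using permutes_inv[OF \<sigma>p] permutes_inv[OF \<rho>p] by (simp add: permutes_not_in)
    next
      case False
      then show ?thesis
        using fun_cong[of _ _ v] eq that by (fastforce simp: F_def restrict_def)
    qed
    \<comment> \<open>A value up to \<open>k\<close> sits at the same position in both permutations,
      whichever of them is known to take it at \<open>p\<close>.\<close>
    have le1: "\<rho> p = \<sigma> p" if "\<sigma> p \<le> k" for p
      using val[OF that] by (metis \<sigma>p \<rho>p permutes_inverses)
    have le2: "\<rho> p = \<sigma> p" if "\<rho> p \<le> k" for p
      using val[OF that] by (metis \<sigma>p \<rho>p permutes_inverses)
    \<comment> \<open>The positions in \<open>{1..n}\<close> that \<open>pos\<close>,
      \<open>le1\<close> and \<open>le2\<close> leave open.\<close>
    let ?P = "{p \<in> {i<..n}. k < \<sigma> p \<and> k < \<rho> p}"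
    \<comment> \<open>Here \<open>\<sigma>\<close> and \<open>\<rho>\<close> are rebound, so that
      the inclusion serves in both directions. The value \<open>\<sigma> p\<close> is taken by
      \<open>\<rho>\<close> at some \<open>q\<close>; \<open>q \<le> i\<close> would give
      \<open>q = p\<close>, and \<open>\<sigma> q \<le> k\<close> would give
      \<open>\<rho> q = \<sigma> q \<le> k\<close>.\<close>
    have image: "\<sigma> ` {p \<in> {i<..n}. k < \<sigma> p \<and> k < \<rho> p}
        \<subseteq> \<rho> ` {p \<in> {i<..n}. k < \<sigma> p \<and> k < \<rho> p}"
      if "\<sigma> permutes {1..n}" "\<rho> permutes {1..n}" "\<And>p. p \<le> i \<Longrightarrow> \<sigma> p = \<rho> p"
        "\<And>p. \<sigma> p \<le> k \<Longrightarrow> \<rho> p = \<sigma> p" for \<sigma> \<rho> :: "nat \<Rightarrow> nat"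
    proof
      fix v assume "v \<in> \<sigma> ` {p \<in> {i<..n}. k < \<sigma> p \<and> k < \<rho> p}"
      then obtain p where p: "v = \<sigma> p" "i < p" "p \<le> n" "k < \<sigma> p" "k < \<rho> p"
        by auto
      define q where "q = inv \<rho> v"
      have q: "\<rho> q = v"
        unfolding q_def using that(2) by (simp add: permutes_inverses)
      have "i < q"
      proof (rule ccontr)
        assume "\<not> i < q"
        then have "\<sigma> q = \<sigma> p"
          using that(3)[of q] q p by simp
        then have "q = p"
          using permutes_inj[OF that(1)] by (simp add: inj_eq)
        with \<open>\<not> i < q\<close> p show False by simp
      qed
      moreover have "v \<in> {1..n}"
        using p permutes_in_image[OF that(1), of p] i by auto
      then have "q \<in> {1..n}"
        unfolding q_def using permutes_in_image[OF permutes_inv[OF that(2)]] by blast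
      moreover have "k < \<sigma> q"
        using that(4)[of q] q p by (metis not_le)
      ultimately show "v \<in> \<rho> ` {p \<in> {i<..n}. k < \<sigma> p \<and> k < \<rho> p}"
        using q p by force
    qed
    show "\<sigma> = \<rho>"
    proof
      fix p
      show "\<sigma> p = \<rho> p"
      proof (cases "p \<in> ?P")
        case True
        show ?thesis
        proof (rule order_agree_imp_eq[of \<sigma> ?P \<rho>])
          have "\<rho> ` {p \<in> {i<..n}. k < \<rho> p \<and> k < \<sigma> p} \<subseteq> \<sigma> ` {p \<in> {i<..n}. k < \<rho> p \<and> k < \<sigma> p}"
            using \<sigma>p \<rho>p pos le2 by (intro image) auto
          moreover have "\<sigma> ` ?P \<subseteq> \<rho> ` ?P"
            using \<sigma>p \<rho>p pos le1 by (intro image) auto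
          ultimately show "\<sigma> ` ?P = \<rho> ` ?P"
            by (auto simp: conj_commute)
          show "\<sigma> x < \<sigma> y \<longleftrightarrow> \<rho> x < \<rho> y" if "x \<in> ?P" "y \<in> ?P" for x y
            using that tail[OF \<sigma>, of x y] tail[OF \<rho>, of x y] by simp
        qed (fact True)
      next
        case False
        then consider "p \<le> i" | "n < p" | "\<sigma> p \<le> k" | "\<rho> p \<le> k"
          by force
        then show ?thesis
        proof cases
          case 1
          then show ?thesis
            by (rule pos)
        next
          case 2
          then show ?thesis
            using \<sigma>p \<rho>p by (simp add: permutes_not_in)
        next
          case 3
          then show ?thesis
            by (rule le1[symmetric])
        next
          case 4
          then show ?thesis
            by (rule le2[symmetric])
        qed
      qed
    qed
  qed
  moreover have "F ` ?S \<subseteq> ?T"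
  proof
    fix t assume "t \<in> F ` ?S"
    then obtain \<sigma> where \<sigma>: "\<sigma> \<in> ?S" "t = F \<sigma>"
      by blast
    note \<sigma>p = perm[OF \<sigma>(1)]
    have "\<sigma> p \<in> {1..n}" "inv \<sigma> p \<in> {1..n}" if "p \<in> {1..n}" for p
      using that
      by (simp_all only: permutes_in_image[OF \<sigma>p] permutes_in_image[OF permutes_inv[OF \<sigma>p]])
    then show "t \<in> ?T"
      using i k by (auto simp: \<sigma> F_def)
  qed
  moreover have "finite ?T"
    by (intro finite_cartesian_product finite_PiE) auto
  ultimately have "card ?S \<le> card ?T"
    by (rule card_inj_on_le)
  also have "card ?T = n ^ (i + k)"
    by (simp add: card_cartesian_product card_PiE power_add)
  finally show ?thesis .
qed

section \<open>Exponential lower bound for the number of avoiders\<close>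

text \<open>
  A new minimum in one of the last two places is followed by at most one entry, so it cannot play
  the role of the leading 1 of the pattern.
\<close>
lemma card_Avoiding_Suc_ge:
  assumes \<tau>: "\<tau> \<in> Sym 3" "\<tau> 1 = 1" and n: "1 \<le> n"
  shows "2 * card (Avoiding n 3 \<tau>) \<le> card (Avoiding (Suc n) 3 \<tau>)"
proof -
  \<comment> \<open>Since \<open>\<sigma>\<close> fixes \<open>Suc n\<close>, cycling the values by
    \<open>c\<close> puts a new minimum in place \<open>Suc n\<close> and raises the old entries by
    one; \<open>G\<close> then exchanges the last two places.\<close>
  define c where "c x = (if x \<in> {1..n} then Suc x else if x = Suc n then 1 else x)" for x
  define F where "F \<sigma> = c \<circ> \<sigma>" for \<sigma> :: "nat \<Rightarrow> nat"
  define G where "G \<sigma> = F \<sigma> \<circ> Transposition.transpose n (Suc n)" for \<sigma>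
  have inj_c: "inj c"
    by (auto simp: inj_def c_def split: if_splits)
  have "bij_betw c {1..Suc n} {1..Suc n}"
    by (rule bij_betw_byWitness[where f' = "\<lambda>y. if y = 1 then Suc n else y - 1"])
      (auto simp: c_def)
  then have c: "c permutes {1..Suc n}"
    by (rule bij_imp_permutes) (auto simp: c_def)
  have F_Sym: "F \<sigma> \<in> Sym (Suc n)" and G_Sym: "G \<sigma> \<in> Sym (Suc n)" if "\<sigma> \<in> Sym n" for \<sigma>
  proof -
    have "\<sigma> permutes {1..Suc n}"
      using that permutes_subset[of \<sigma> "{1..n}" "{1..Suc n}"] by (simp add: Sym_def)
    then show F: "F \<sigma> \<in> Sym (Suc n)"
      unfolding F_def Sym_def using c by (auto intro: permutes_compose)
    have "Transposition.transpose n (Suc n) permutes {1..Suc n}"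
      using n by (intro permutes_swap_id) auto
    with F show "G \<sigma> \<in> Sym (Suc n)"
      unfolding G_def Sym_def by (auto intro: permutes_compose)
  qed
  have F_val: "F \<sigma> x = (if x \<in> {1..n} then Suc (\<sigma> x) else if x = Suc n then 1 else x)"
    if "\<sigma> \<in> Sym n" for \<sigma> x
    using that permutes_in_image[of \<sigma> "{1..n}" x] permutes_not_in[of \<sigma> "{1..n}" x]
    by (auto simp: F_def c_def Sym_def)
  have G_val: "G \<sigma> x = (if x = n then 1 else if x = Suc n then Suc (\<sigma> n) else F \<sigma> x)"
    if "\<sigma> \<in> Sym n" for \<sigma> x
    using n that by (auto simp: G_def F_val Transposition.transpose_def)
  have F_av: "F \<sigma> \<in> Avoiding (Suc n) 3 \<tau>" and G_av: "G \<sigma> \<in> Avoiding (Suc n) 3 \<tau>"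
    if "\<sigma> \<in> Avoiding n 3 \<tau>" for \<sigma>
  proof -
    have \<sigma>: "\<sigma> \<in> Sym n"
      using that by (simp add: Avoiding_def)
    note av = that[unfolded Avoiding_iff[OF \<tau> \<sigma>], rule_format]
    show "F \<sigma> \<in> Avoiding (Suc n) 3 \<tau>"
      unfolding Avoiding_iff[OF \<tau> F_Sym[OF \<sigma>]]
    proof (intro allI impI, elim conjE)
      fix a b d assume H: "1 \<le> a" "a < b" "b < d" "d \<le> Suc n" "F \<sigma> a < F \<sigma> b" "F \<sigma> a < F \<sigma> d"
      then have "d \<noteq> Suc n"
        by (auto simp: F_val[OF \<sigma>])
      with H show "F \<sigma> b < F \<sigma> d \<longleftrightarrow> \<not> \<tau> 2 < \<tau> 3"
        using av[of a b d] by (auto simp: F_val[OF \<sigma>])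
    qed
    show "G \<sigma> \<in> Avoiding (Suc n) 3 \<tau>"
      unfolding Avoiding_iff[OF \<tau> G_Sym[OF \<sigma>]]
    proof (intro allI impI, elim conjE)
      fix a b d assume H: "1 \<le> a" "a < b" "b < d" "d \<le> Suc n" "G \<sigma> a < G \<sigma> b" "G \<sigma> a < G \<sigma> d"
      moreover have "0 < F \<sigma> a"
        using H(1) by (simp add: F_val[OF \<sigma>])
      ultimately have "b \<noteq> n" "d \<noteq> n"
        by (auto simp: G_val[OF \<sigma>])
      \<comment> \<open>The last entry of \<open>G \<sigma>\<close> is the old entry at
        \<open>n\<close> raised by one, so a triple ending at \<open>Suc n\<close> comes from a
        triple of \<open>\<sigma>\<close> ending at \<open>n\<close>; \<open>b \<noteq> n\<close>
        keeps its middle position before \<open>n\<close>.\<close>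
      with H show "G \<sigma> b < G \<sigma> d \<longleftrightarrow> \<not> \<tau> 2 < \<tau> 3"
        using av[of a b "if d = Suc n then n else d"]
        by (auto simp: G_val[OF \<sigma>] F_val[OF \<sigma>] split: if_splits)
    qed
  qed
  let ?A = "Avoiding n 3 \<tau>"
  have F_inj: "inj_on F ?A"
    by (rule inj_onI) (use inj_c in \<open>auto simp: F_def fun_eq_iff inj_eq\<close>)
  have G_inj: "inj_on G ?A"
  proof (rule inj_onI)
    fix \<sigma> \<rho> assume "\<sigma> \<in> ?A" "\<rho> \<in> ?A" "G \<sigma> = G \<rho>"
    then have "F \<sigma> = F \<rho>"
      unfolding G_def by (metis comp_assoc comp_id transpose_comp_involutory)
    with F_inj \<open>\<sigma> \<in> ?A\<close> \<open>\<rho> \<in> ?A\<close> show "\<sigma> = \<rho>"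
      by (auto dest: inj_onD)
  qed
  have "F ` ?A \<inter> G ` ?A = {}"
  proof -
    \<comment> \<open>Place \<open>n\<close> tells the two images apart: \<open>G\<close> has the
      new minimum 1 there, \<open>F\<close> a raised value of at least 2.\<close>
    have "F \<sigma> \<noteq> G \<rho>" if "\<sigma> \<in> ?A" "\<rho> \<in> ?A" for \<sigma> \<rho>
    proof
      assume "F \<sigma> = G \<rho>"
      then have "F \<sigma> n = G \<rho> n"
        by simp
      moreover have "\<sigma> n \<in> {1..n}"
        using that n permutes_in_image[of \<sigma> "{1..n}" n] by (auto simp: Avoiding_def Sym_def)
      ultimately show False
        using that n F_val[of \<sigma> n] G_val[of \<rho> n] by (auto simp: Avoiding_def)
    qed
    then show ?thesis by blast
  qed
  then have "card (F ` ?A \<union> G ` ?A) = 2 * card ?A"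
    using F_inj G_inj finite_Avoiding by (subst card_Un_disjoint) (auto simp: card_image)
  moreover have "card (F ` ?A \<union> G ` ?A) \<le> card (Avoiding (Suc n) 3 \<tau>)"
    using F_av G_av by (intro card_mono finite_Avoiding) auto
  ultimately show ?thesis
    by simp
qed

text \<open>Doubling is available from \<open>n = 1\<close> on; lengths 0 and 1 are settled by the
  identity, which is too short to contain the pattern. The factor 2 on the right avoids the exponent
  \<open>n - 1\<close>.\<close>

lemma card_Avoiding_ge:
  assumes \<tau>: "\<tau> \<in> Sym 3" "\<tau> 1 = 1"
  shows "2 ^ n \<le> 2 * card (Avoiding n 3 \<tau>)"
proof -
  have small: "1 \<le> card (Avoiding m 3 \<tau>)" if "m \<le> 1" for m
  proof -
    have "id \<in> Sym m"
      by (simp add: Sym_def)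
    then have "id \<in> Avoiding m 3 \<tau>"
      using that by (subst Avoiding_iff[OF \<tau>]) auto
    then show ?thesis
      using finite_Avoiding[of m 3 \<tau>] by (auto simp: Suc_le_eq card_gt_0_iff)
  qed
  show ?thesis
  proof (induction n)
    case 0
    then show ?case
      using small[of 0] by simp
  next
    case (Suc n)
    then show ?case
      using small[of 1] card_Avoiding_Suc_ge[OF \<tau>, of n] by (cases n) auto
  qed
qed

section \<open>Entries tend to infinity in probability\<close>

text \<open>For fixed \<open>i\<close> and \<open>k\<close> the numerator is bounded by a polynomial
  in \<open>n\<close>, while the denominator is at least \<open>2 ^ n / 2\<close>.\<close>

lemma Avoiding_value_tendsto:
  assumes \<tau>: "\<tau> \<in> Sym 3" "\<tau> 1 = 1" and i: "1 \<le> i"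
  shows "(\<lambda>n. card {\<sigma> \<in> Avoiding n 3 \<tau>. \<sigma> i = k} / card (Avoiding n 3 \<tau>)) \<longlonglongrightarrow> 0"
proof (rule tendsto_sandwich[OF _ _ tendsto_const])
  show "(\<lambda>n. real n ^ (i + k) / (2 ^ n / 2)) \<longlonglongrightarrow> 0"
    by real_asymp
  show "\<forall>\<^sub>F n in sequentially.
    card {\<sigma> \<in> Avoiding n 3 \<tau>. \<sigma> i = k} / card (Avoiding n 3 \<tau>) \<le> real n ^ (i + k) / (2 ^ n / 2)"
    using eventually_ge_at_top[of i] eventually_ge_at_top[of k]
  proof eventually_elim
    case (elim n)
    have "real (2 ^ n) \<le> real (2 * card (Avoiding n 3 \<tau>))"
      using card_Avoiding_ge[OF \<tau>] by (simp only: of_nat_le_iff)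
    moreover have "real (card {\<sigma> \<in> Avoiding n 3 \<tau>. \<sigma> i = k}) \<le> real (n ^ (i + k))"
      using card_Avoiding_value_le[OF \<tau> i elim] by (simp only: of_nat_le_iff)
    ultimately show ?case
      by (intro frac_le) auto
  qed
qed auto

section \<open>Distance to the constant sequence\<close>

text \<open>The indices of the sum start at \<open>k\<close> or later, and the geometric series from
  \<open>k\<close> on has total \<open>2 * (1 / 2) ^ k\<close>.\<close>

lemma dist_enat_infinity_le:
  assumes "enat k \<le> x"
  shows "dist_enat x \<infinity> \<le> 2 * (1 / 2) ^ k"
proof -
  have "((\<lambda>j. (1 / 2 :: real) ^ j) has_sum 2) UNIV"
    using geometric_sums[of "1 / 2 :: real"] by (intro norm_summable_imp_has_sum) auto
  then have "((\<lambda>j. (1 / 2 :: real) ^ k * (1 / 2) ^ j) has_sum ((1 / 2) ^ k * 2)) UNIV"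
    by (rule has_sum_cmult_right)
  then have "((\<lambda>j. (1 / 2 :: real) ^ j) has_sum ((1 / 2) ^ k * 2)) (range ((+) k))"
    by (subst has_sum_reindex) (auto simp: o_def power_add)
  then have "infsum (\<lambda>j. (1 / 2 :: real) ^ j) (range ((+) k)) = (1 / 2) ^ k * 2"
    by (rule infsumI)
  moreover have "dist_enat x \<infinity> \<le> infsum (\<lambda>j. (1 / 2 :: real) ^ j) (range ((+) k))"
    unfolding dist_enat_def
  proof (intro infsum_mono2 half_summable_on)
    show "{j. min x \<infinity> \<le> enat j \<and> enat j < max x \<infinity>} \<subseteq> range ((+) k)"
    proof
      fix j assume "j \<in> {j. min x \<infinity> \<le> enat j \<and> enat j < max x \<infinity>}"
      then have "x \<le> enat j"
        by (auto simp: min_def split: if_splits)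
      with assms have "enat k \<le> enat j"
        by (rule order_trans)
      then show "j \<in> range ((+) k)"
        by (auto dest: le_Suc_ex)
    qed
  qed auto
  ultimately show ?thesis
    by simp
qed

text \<open>\<open>K\<close> is both the number of coordinates controlled and their least height.
  The first \<open>K\<close> coordinates have total weight at most 1 and distance at most
  \<open>2 * (1 / 2) ^ K\<close>; the others have total weight \<open>(1 / 2) ^ K\<close> and
  distance at most 2.\<close>

lemma D_infinity_seq_le:
  assumes "\<And>i. i \<in> {1..K} \<Longrightarrow> enat K \<le> x i"
  shows "D x infinity_seq \<le> 4 * (1 / 2) ^ K"
proof -
  let ?t = "\<lambda>i. (1 / 2 :: real) ^ Suc i * dist_enat (x (Suc i)) (infinity_seq (Suc i))"
  let ?u = "\<lambda>i. (1 / 2 :: real) ^ Suc i"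
  have inf: "infinity_seq (Suc i) = \<infinity>" for i
    by (simp add: infinity_seq_def)
  have u: "?u sums 1"
    using power_half_series by simp
  have "(\<Sum>i<K. ?t i) \<le> (\<Sum>i<K. ?u i * (2 * (1 / 2) ^ K))"
    unfolding inf using assms by (intro sum_mono mult_left_mono dist_enat_infinity_le) auto
  also have "\<dots> = 2 * (1 / 2) ^ K * (\<Sum>i<K. ?u i)"
    by (simp add: sum_distrib_left mult_ac)
  also have "(\<Sum>i<K. ?u i) \<le> 1"
    using u by (metis sums_iff sum_le_suminf finite_lessThan zero_le_power zero_le_divide_1_iff zero_le_numeral)
  finally have 1: "(\<Sum>i<K. ?t i) \<le> 2 * (1 / 2) ^ K"
    by simp
  have v: "(\<lambda>i. 2 * (1 / 2) ^ K * ?u i) sums (2 * (1 / 2) ^ K)"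
    using sums_mult[OF u, of "2 * (1 / 2) ^ K"] by simp
  have "(\<Sum>i. ?t (i + K)) \<le> (\<Sum>i. 2 * (1 / 2) ^ K * ?u i)"
  proof (rule suminf_le)
    show "?t (i + K) \<le> 2 * (1 / 2) ^ K * ?u i" for i
    proof -
      \<comment> \<open>The trivial lower bound 0 on an entry yields the distance bound 2 for the
        coordinates about which nothing is assumed.\<close>
      have "?t (i + K) \<le> ?u (i + K) * (2 * (1 / 2) ^ 0)"
        unfolding inf by (intro mult_left_mono dist_enat_infinity_le) (auto simp: zero_enat_def[symmetric])
      then show ?thesis
        by (simp add: power_add mult_ac)
    qed
    show "summable (\<lambda>i. ?t (i + K))"
      by (rule iffD2[OF summable_iff_shift[of ?t K] D_summable])
    show "summable (\<lambda>i. 2 * (1 / 2) ^ K * ?u i)"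
      using v by (rule sums_summable)
  qed
  also have "\<dots> = 2 * (1 / 2) ^ K"
    using v by (rule sums_unique[symmetric])
  finally have "(\<Sum>i. ?t (i + K)) \<le> 2 * (1 / 2) ^ K" .
  with 1 show ?thesis
    unfolding D_def by (subst suminf_split_initial_segment[OF D_summable, of _ _ K]) simp
qed

section \<open>Borel sets and weak convergence\<close>

lemma space_borel_of: "space (borel_of X) = topspace X"
  by (simp add: borel_of_def space_measure_of_conv)

lemma sets_borel_of: "sets (borel_of X) = sigma_sets (topspace X) {U. openin X U}"
  unfolding borel_of_def by (rule sets_measure_of) (auto dest: openin_subset)

lemma continuous_map_borel_of_measurable:
  assumes "continuous_map X euclideanreal f"
  shows "f \<in> borel_measurable (borel_of X)"
proof (rule borel_measurableI)
  fix S :: "real set" assume "open S"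
  then have "openin X {x \<in> topspace X. f x \<in> S}"
    using assms by (simp add: openin_continuous_map_preimage)
  moreover have "f -` S \<inter> space (borel_of X) = {x \<in> topspace X. f x \<in> S}"
    by (auto simp: space_borel_of)
  ultimately show "f -` S \<inter> space (borel_of X) \<in> sets (borel_of X)"
    by (auto simp: sets_borel_of)
qed

text \<open>For a test function bounded by \<open>b\<close>, the integral differs from the value at
  \<open>infinity_seq\<close> by at most \<open>e / 2\<close> plus \<open>2 * b\<close> times the
  probability that one of the first \<open>K\<close> entries is below \<open>K\<close>. That
  probability tends to 0.\<close>

lemma weak_conv_on_Avoiding:
  assumes \<tau>: "\<tau> \<in> Sym 3" "\<tau> 1 = 1"
  shows "weak_conv_on SNN.mtopology (\<mu> 3 \<tau>) (return (borel_of SNN.mtopology) infinity_seq)"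
proof -
  let ?A = "\<lambda>n. Avoiding n 3 \<tau>" and ?B = "borel_of SNN.mtopology"
  have inf: "infinity_seq \<in> space ?B"
    by (simp add: space_borel_of infinity_seq_in_SNN)
  have card_pos: "0 < card (?A n)" for n
    using card_Avoiding_ge[OF \<tau>, of n] by (metis mult_0_right not_gr_zero power_not_zero zero_neq_numeral le_zero_eq)
  have ne: "?A n \<noteq> {}" for n
    using card_pos[of n] by auto
  have SNN: "embed \<sigma> \<in> SNN" if "\<sigma> \<in> ?A n" for \<sigma> n
    using that by (auto simp: Avoiding_def intro: embed_in_SNN)
  have embed: "embed \<in> measurable (uniform_count_measure (?A n)) ?B" for n
    by (rule measurableI) (auto simp: space_uniform_count_measure sets_uniform_count_measure space_borel_of SNN)
  have conv: "(\<lambda>n. \<integral>x. f x \<partial>\<mu> 3 \<tau> n) \<longlonglongrightarrow> (\<integral>x. f x \<partial>return ?B infinity_seq)"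
    if f: "continuous_map SNN.mtopology euclideanreal f" and bdd: "bounded (f ` topspace SNN.mtopology)" for f
  proof -
    note meas = continuous_map_borel_of_measurable[OF f]
    have lim: "(\<integral>x. f x \<partial>return ?B infinity_seq) = f infinity_seq"
      using inf meas by (rule integral_return)
    have int: "(\<integral>x. f x \<partial>\<mu> 3 \<tau> n) = (\<Sum>\<sigma>\<in>?A n. f (embed \<sigma>)) / card (?A n)" for n
      unfolding \<mu>_def integral_distr[OF embed meas]
      unfolding uniform_count_measure_def
      by (subst lebesgue_integral_point_measure_finite) (simp_all add: finite_Avoiding sum_divide_distrib)
    obtain b where b: "\<And>x. x \<in> SNN \<Longrightarrow> \<bar>f x\<bar> \<le> b"
      using bdd by (auto simp: bounded_iff)
    have b0: "0 \<le> b"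
      using b[OF infinity_seq_in_SNN] by linarith
    show ?thesis
      unfolding lim
    proof (rule LIMSEQ_I)
      fix e :: real assume e: "0 < e"
      have "openin SNN.mtopology {x \<in> topspace SNN.mtopology. f x \<in> ball (f infinity_seq) (e / 2)}"
        using f by (rule openin_continuous_map_preimage) simp
      then obtain r where r: "0 < r" "SNN.mball infinity_seq r \<subseteq> {x \<in> SNN. f x \<in> ball (f infinity_seq) (e / 2)}"
        using e infinity_seq_in_SNN unfolding SNN.openin_mtopology by auto
      have "(\<lambda>K. 4 * (1 / 2 :: real) ^ K) \<longlonglongrightarrow> 0"
        by real_asymp
      then obtain K where K: "4 * (1 / 2 :: real) ^ K < r"
        using r(1) by (metis (no_types, lifting) eventually_sequentially order_refl order_tendstoD(2))
      \<comment> \<open>The exceptional permutations. Outside \<open>E n\<close> the first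
        \<open>K\<close> entries are all at least \<open>K\<close>, and the choice of
        \<open>K\<close> puts \<open>embed \<sigma>\<close> in the ball of radius
        \<open>r\<close>.\<close>
      define E where "E n = {\<sigma> \<in> ?A n. \<exists>i\<in>{1..K}. \<sigma> i < K}" for n
      have close: "\<bar>f (embed \<sigma>) - f infinity_seq\<bar> \<le> e / 2" if "\<sigma> \<in> ?A n" "\<sigma> \<notin> E n" for \<sigma> n
      proof -
        have "D (embed \<sigma>) infinity_seq \<le> 4 * (1 / 2) ^ K"
          using that by (intro D_infinity_seq_le) (auto simp: E_def embed_def not_less)
        then have "embed \<sigma> \<in> SNN.mball infinity_seq r"
          using K SNN[OF that(1)] infinity_seq_in_SNN by (simp add: SNN.commute)
        then have "f (embed \<sigma>) \<in> ball (f infinity_seq) (e / 2)"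
          using r(2) by blast
        then show ?thesis
          by (simp add: dist_real_def abs_minus_commute)
      qed
      \<comment> \<open>The double sum is the union bound for the probability of \<open>E n\<close>:
        finitely many pairs of a position \<open>i\<close> and a value \<open>k\<close>, each with a
        fraction tending to 0.\<close>
      have "(\<lambda>n. 2 * b * (\<Sum>i\<in>{1..K}. \<Sum>k<K. card {\<sigma> \<in> ?A n. \<sigma> i = k} / card (?A n)))
        \<longlonglongrightarrow> 2 * b * (\<Sum>i\<in>{1..K}. \<Sum>k<K. 0)"
        by (intro tendsto_intros Avoiding_value_tendsto \<tau>) auto
      then have "\<forall>\<^sub>F n in sequentially.
        2 * b * (\<Sum>i\<in>{1..K}. \<Sum>k<K. card {\<sigma> \<in> ?A n. \<sigma> i = k} / card (?A n)) < e / 2"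
        using e by (intro order_tendstoD(2)) auto
      then obtain N where N: "\<And>n. n \<ge> N \<Longrightarrow>
        2 * b * (\<Sum>i\<in>{1..K}. \<Sum>k<K. card {\<sigma> \<in> ?A n. \<sigma> i = k} / card (?A n)) < e / 2"
        by (auto simp: eventually_sequentially)
      have "norm ((\<integral>x. f x \<partial>\<mu> 3 \<tau> n) - f infinity_seq) < e" if "n \<ge> N" for n
      proof -
        let ?c = "real (card (?A n))"
        have c: "0 < ?c"
          using card_pos by simp
        have "card (E n) \<le> (\<Sum>i\<in>{1..K}. card (\<Union>k<K. {\<sigma> \<in> ?A n. \<sigma> i = k}))"
        proof -
          have "E n = (\<Union>i\<in>{1..K}. \<Union>k<K. {\<sigma> \<in> ?A n. \<sigma> i = k})"
            by (auto simp: E_def)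
          then show ?thesis
            by (simp add: card_UN_le)
        qed
        also have "\<dots> \<le> (\<Sum>i\<in>{1..K}. \<Sum>k<K. card {\<sigma> \<in> ?A n. \<sigma> i = k})"
          by (intro sum_mono card_UN_le) simp
        finally have "real (card (E n)) \<le> real (\<Sum>i\<in>{1..K}. \<Sum>k<K. card {\<sigma> \<in> ?A n. \<sigma> i = k})"
          by (simp only: of_nat_le_iff)
        then have "card (E n) / ?c \<le> (\<Sum>i\<in>{1..K}. \<Sum>k<K. card {\<sigma> \<in> ?A n. \<sigma> i = k} / ?c)"
          using c by (simp add: divide_right_mono flip: sum_divide_distrib)
        then have "2 * b * (card (E n) / ?c) < e / 2"
          using N[OF that] b0 mult_left_mono[of _ _ "2 * b"] by (smt (verit))
        then have bad: "2 * b * card (E n) < e / 2 * ?c"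
          using c by (simp add: field_simps)
        have "\<bar>(\<Sum>\<sigma>\<in>?A n. f (embed \<sigma>)) - f infinity_seq * ?c\<bar>
          = \<bar>\<Sum>\<sigma>\<in>?A n. f (embed \<sigma>) - f infinity_seq\<bar>"
          by (simp add: sum_subtractf mult.commute)
        also have "\<dots> \<le> (\<Sum>\<sigma>\<in>?A n. \<bar>f (embed \<sigma>) - f infinity_seq\<bar>)"
          by (rule sum_abs)
        \<comment> \<open>Outside \<open>E n\<close> continuity gives \<open>e / 2\<close>; on
          \<open>E n\<close> two values of \<open>f\<close> differ by at most
          \<open>2 * b\<close>.\<close>
        also have "\<dots> \<le> (\<Sum>\<sigma>\<in>?A n. e / 2 + (if \<sigma> \<in> E n then 2 * b else 0))"
        proof (rule sum_mono)
          fix \<sigma> assume \<sigma>: "\<sigma> \<in> ?A n"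
          show "\<bar>f (embed \<sigma>) - f infinity_seq\<bar> \<le> e / 2 + (if \<sigma> \<in> E n then 2 * b else 0)"
            using close[OF \<sigma>] b[OF SNN[OF \<sigma>]] b[OF infinity_seq_in_SNN] e by auto
        qed
        also have "\<dots> = ?c * (e / 2) + 2 * b * card (E n)"
        proof -
          have "?A n \<inter> E n = E n"
            by (auto simp: E_def)
          then show ?thesis
            by (simp add: sum.distrib flip: sum.inter_restrict[OF finite_Avoiding])
        qed
        also have "\<dots> < e * ?c"
          using bad by (simp add: field_simps)
        finally have "\<bar>(\<Sum>\<sigma>\<in>?A n. f (embed \<sigma>)) - f infinity_seq * ?c\<bar> / ?c < e"
          using c by (simp add: pos_divide_less_eq)
        moreover have "(\<Sum>\<sigma>\<in>?A n. f (embed \<sigma>)) / ?c - f infinity_seq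
          = ((\<Sum>\<sigma>\<in>?A n. f (embed \<sigma>)) - f infinity_seq * ?c) / ?c"
          using c by (simp add: diff_divide_distrib)
        ultimately show ?thesis
          unfolding int by (simp add: abs_divide)
      qed
      then show "\<exists>N. \<forall>n\<ge>N. norm ((\<integral>x. f x \<partial>\<mu> 3 \<tau> n) - f infinity_seq) < e"
        by blast
    qed
  qed
  have prob: "prob_space (\<mu> 3 \<tau> n)" for n
    unfolding \<mu>_def
    by (intro prob_space.prob_space_distr prob_space_uniform_count_measure embed finite_Avoiding ne)
  show ?thesis
    unfolding weak_conv_on_def
    using prob conv prob_space_return[OF inf] by (simp add: \<mu>_def)
qed

text \<open>Both 123 and 132 begin with their smallest letter, so each is an instance of
  \<open>weak_conv_on_Avoiding\<close>.\<close>

theorem proposition1: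
  shows "weak_conv_on SNN.mtopology (\<mu> 3 (one_line [1, 2, 3]))
           (return (borel_of SNN.mtopology) infinity_seq) \<and>
         weak_conv_on SNN.mtopology (\<mu> 3 (one_line [1, 3, 2]))
           (return (borel_of SNN.mtopology) infinity_seq)"
  by (intro conjI weak_conv_on_Avoiding one_line_123_in_Sym one_line_132_in_Sym)
    (simp_all add: one_line_def)

end
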